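(* Let $S=\{m^n : m,n\in\mathbb{Z},\ m\ge 2,\ n\ge 2\}$ be the set of all integers that are powers (squares or higher) of integers greater than one, each such number being counted only once. Then the infinite series $$\sum_{s\in S}\frac{1}{s-1}=\frac13+\frac17+\frac18+\frac1{15}+\frac1{24}+\frac1{26}+\frac1{31}+\frac1{35}+\cdots,$$ whose denominators increased by one are exactly the elements of $S$, has sum $1$. *)

theory Defs
  imports "HOL-Analysis.Analysis"
begin

(* The exponent is a natural number: only exponents \<ge> 2 occur, so no negative powers are needed. *)
definition proper_powers :: "int set" where
  "proper_powers = {m ^ n | (m :: int) (n :: nat). m \<ge> 2 \<and> n \<ge> 2}"

end

theory Submission
  imports Defs "HOL-Computational_Algebra.Nth_Powers"
begin

text \<open>
  Every integer \<open>m \<ge> 2\<close> is \<open>r ^ k\<close> for a unique \<open>r\<close> that is not a perfect power and a unique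
  \<open>k \<ge> 1\<close>. Consider the family \<open>1 / r ^ (k * j)\<close>, with \<open>r\<close> not a perfect power, \<open>k \<ge> 2\<close> and
  \<open>j \<ge> 1\<close>. Grouped by \<open>s = r ^ k\<close>, the geometric series over \<open>j\<close> gives the sum of
  \<open>1 / (s - 1)\<close> over the perfect powers \<open>s\<close>. Grouped by \<open>m = r ^ j\<close>, which runs over all
  integers at least 2, the geometric series over \<open>k\<close> gives the telescoping sum of
  \<open>1 / (m - 1) - 1 / m\<close>, which is 1. All terms are nonnegative, so the two sums agree.
\<close>

section \<open>Primitive bases and unique representation as a power\<close>

definition perfect_powers :: "nat set" where
  "perfect_powers = {m ^ n | m n. m \<ge> 2 \<and> n \<ge> 2}"

definition primitive_bases :: "nat set" where
  "primitive_bases = {2..} - perfect_powers"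

lemma perfect_powersI: "m \<ge> 2 \<Longrightarrow> n \<ge> 2 \<Longrightarrow> m ^ n \<in> perfect_powers"
  by (auto simp: perfect_powers_def)

lemma power_ge_2: "2 \<le> m ^ n" if "2 \<le> m" "1 \<le> n" for m n :: nat
proof -
  have "m ^ 1 \<le> m ^ n"
    using that by (intro power_increasing) auto
  then show ?thesis
    using that by simp
qed

lemma perfect_powers_ge_2: "s \<in> perfect_powers \<Longrightarrow> s \<ge> 2"
  by (auto simp: perfect_powers_def intro: power_ge_2)

text \<open>Comparing multiplicities of each prime, with the exponents reduced by their gcd to
  coprime \<open>k'\<close> and \<open>l'\<close>, shows that \<open>l'\<close> divides every
  multiplicity in \<open>r\<close>. So \<open>r\<close> is an \<open>l'\<close>-th power, and
  primitivity forces \<open>l' = 1\<close>.\<close>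

lemma primitive_bases_power_eq_imp_dvd:
  assumes r: "r \<in> primitive_bases" and eq: "r ^ k = q ^ l" and "k > 0" "l > 0"
  shows "l dvd k"
proof -
  have r2: "r \<ge> 2" "r \<notin> perfect_powers"
    using r by (auto simp: primitive_bases_def)
  have "q \<noteq> 0"
    using eq r2 \<open>l > 0\<close> by (intro notI) (simp add: zero_power)
  obtain k' l' where kl: "k = k' * gcd k l" "l = l' * gcd k l" "coprime k' l'"
    using gcd_coprime_exists[of k l] \<open>k > 0\<close> by auto
  have "l' > 0"
    using kl(2) \<open>l > 0\<close> by (cases l') auto
  have "l' dvd multiplicity p r" if "prime p" for p
  proof -
    have "k * multiplicity p r = l * multiplicity p q"
      using arg_cong[OF eq, of "multiplicity p"] that r2 \<open>q \<noteq> 0\<close>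
      by (simp add: prime_elem_multiplicity_power_distrib)
    then have "gcd k l * (k' * multiplicity p r) = gcd k l * (l' * multiplicity p q)"
      using kl by (metis mult.assoc mult.commute)
    then have "k' * multiplicity p r = l' * multiplicity p q"
      using \<open>k > 0\<close> by simp
    then show ?thesis
      using kl(3) by (metis coprime_commute coprime_dvd_mult_right_iff dvd_triv_left)
  qed
  then have "is_nth_power l' r"
    using is_nth_power_conv_multiplicity_nat[OF \<open>l' > 0\<close>] by blast
  then obtain c where c: "r = c ^ l'"
    by (elim is_nth_powerE)
  have "c \<noteq> 0"
    using c r2 \<open>l' > 0\<close> by (intro notI) (simp add: zero_power)
  moreover have "c \<noteq> 1"
    using c r2 by auto
  \<comment> \<open>Otherwise \<open>r = c ^ l'\<close> would be a perfect power.\<close>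
  ultimately have "\<not> l' \<ge> 2"
    using c r2 perfect_powersI[of c l'] by auto
  then have "l' = 1"
    using \<open>l' > 0\<close> by simp
  then have "l = gcd k l"
    using kl(2) by simp
  then show ?thesis
    by (metis gcd_dvd1)
qed

text \<open>With both bases primitive, the divisibility of exponents holds in both directions. This
  uniqueness makes both regroupings of the triple family injective.\<close>

lemma primitive_bases_power_eq_iff:
  assumes "r \<in> primitive_bases" "q \<in> primitive_bases" "k > 0" "l > 0"
  shows "r ^ k = q ^ l \<longleftrightarrow> r = q \<and> k = l"
proof
  assume eq: "r ^ k = q ^ l"
  then have "k = l"
    using assms primitive_bases_power_eq_imp_dvd[of r k q l]
      primitive_bases_power_eq_imp_dvd[of q l r k] by (simp add: dvd_antisym)
  then show "r = q \<and> k = l"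
    using eq assms by (metis power_eq_iff_eq_base zero_le)
qed simp

text \<open>Existence by descent: a perfect power has a strictly smaller base, to which the
  induction hypothesis applies, and the exponents multiply.\<close>

lemma obtain_primitive_base:
  assumes "m \<ge> (2::nat)"
  obtains r k where "r \<in> primitive_bases" "k \<ge> 1" "m = r ^ k"
proof -
  have "\<exists>r\<in>primitive_bases. \<exists>k\<ge>1. m = r ^ k"
    using assms
  proof (induction m rule: less_induct)
    case (less m)
    show ?case
    proof (cases "m \<in> perfect_powers")
      case True
      then obtain a n where an: "m = a ^ n" "a \<ge> 2" "n \<ge> 2"
        by (auto simp: perfect_powers_def)
      have "a ^ 1 < a ^ n"
        using an by (intro power_strict_increasing) auto
      then obtain r k where rk: "r \<in> primitive_bases" "k \<ge> 1" "a = r ^ k"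
        using less.IH[of a] an by auto
      have "m = r ^ (k * n)" "k * n \<ge> 1"
        using an rk by (auto simp: power_mult)
      then show ?thesis
        using rk by blast
    next
      case False
      then have "m \<in> primitive_bases" "m = m ^ 1"
        using less.prems by (auto simp: primitive_bases_def)
      then show ?thesis
        by blast
    qed
  qed
  then show ?thesis
    using that by blast
qed

section \<open>Two regroupings of the triples \<open>(r, k, j)\<close>\<close>

lemma bij_betw_perfect_powers:
  "bij_betw (\<lambda>(r, k, j). (r ^ k, j)) (primitive_bases \<times> {2..} \<times> {1..}) (perfect_powers \<times> {1::nat..})"
proof (rule bij_betw_imageI)
  show "inj_on (\<lambda>(r, k, j). (r ^ k, j)) (primitive_bases \<times> {2..} \<times> {1::nat..})"
    by (auto simp: inj_on_def primitive_bases_power_eq_iff)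
  have "(s, j) \<in> (\<lambda>(r, k, j). (r ^ k, j)) ` (primitive_bases \<times> {2..} \<times> {1..})"
    if sj: "s \<in> perfect_powers" "j \<ge> 1" for s j :: nat
  proof -
    obtain r k where rk: "r \<in> primitive_bases" "k \<ge> 1" "s = r ^ k"
      using obtain_primitive_base perfect_powers_ge_2[OF sj(1)] by metis
    \<comment> \<open>For \<open>k = 1\<close> the perfect power \<open>s\<close> would itself be a
      primitive base.\<close>
    moreover have "k \<noteq> 1"
      using rk sj by (auto simp: primitive_bases_def)
    ultimately show ?thesis
      using sj by (intro image_eqI[where x = "(r, k, j)"]) auto
  qed
  moreover have "r ^ k \<in> perfect_powers" if "r \<in> primitive_bases" "k \<ge> 2" for r k
    using that by (intro perfect_powersI) (auto simp: primitive_bases_def)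
  ultimately show "(\<lambda>(r, k, j). (r ^ k, j)) ` (primitive_bases \<times> {2..} \<times> {1..}) = perfect_powers \<times> {1::nat..}"
    by (intro equalityI subsetI) auto
qed

text \<open>Now \<open>r\<close> is merged with \<open>j\<close>. Since \<open>j = 1\<close> is
  allowed, \<open>r ^ j\<close> reaches primitive bases as well, hence every integer from 2
  on.\<close>

lemma bij_betw_all_powers:
  "bij_betw (\<lambda>(r, k, j). (r ^ j, k)) (primitive_bases \<times> {2..} \<times> {1..}) ({2..} \<times> {2::nat..})"
proof (rule bij_betw_imageI)
  show "inj_on (\<lambda>(r, k, j). (r ^ j, k)) (primitive_bases \<times> {2::nat..} \<times> {1..})"
    by (auto simp: inj_on_def primitive_bases_power_eq_iff)
  have "(m, k) \<in> (\<lambda>(r, k, j). (r ^ j, k)) ` (primitive_bases \<times> {2..} \<times> {1..})"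
    if mk: "m \<ge> 2" "k \<ge> 2" for m k :: nat
  proof -
    obtain r j where "r \<in> primitive_bases" "j \<ge> 1" "m = r ^ j"
      using obtain_primitive_base[OF mk(1)] by metis
    then show ?thesis
      using mk by (intro image_eqI[where x = "(r, k, j)"]) auto
  qed
  moreover have "r ^ j \<ge> 2" if "r \<in> primitive_bases" "j \<ge> 1" for r j
    using that by (intro power_ge_2) (auto simp: primitive_bases_def)
  ultimately show "(\<lambda>(r, k, j). (r ^ j, k)) ` (primitive_bases \<times> {2..} \<times> {1..}) = {2..} \<times> {2::nat..}"
    by (intro equalityI subsetI) auto
qed

section \<open>Geometric series, telescoping and the double sum\<close>

lemma has_sum_inverse_powers_from_1:
  assumes "m \<ge> (2::nat)"
  shows "((\<lambda>n. 1 / real m ^ n) has_sum 1 / (real m - 1)) {1..}"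
  using has_sum_geometric_from_1[of "1 / real m"] assms
  by (simp add: power_one_over field_simps)

lemma has_sum_inverse_powers_from_2:
  assumes "m \<ge> (2::nat)"
  shows "((\<lambda>n. 1 / real m ^ n) has_sum (1 / (real m - 1) - 1 / real m)) {2..}"
proof -
  have "{1..} - {1} = {2::nat..}"
    by auto
  then show ?thesis
    using has_sum_Diff[OF has_sum_inverse_powers_from_1[OF assms] has_sum_finite[of "{1}"]] by simp
qed

lemma has_sum_telescope_inverse:
  "((\<lambda>m. 1 / (real m - 1) - 1 / real m) has_sum 1) {2..}"
proof -
  have "(\<lambda>n. 1 / real (Suc n)) \<longlonglongrightarrow> 0"
    by (rule LIMSEQ_Suc[OF lim_1_over_n])
  \<comment> \<open>With \<open>m = n + 2\<close> the summand is
    \<open>1 / (n + 1) - 1 / (n + 2)\<close>, so the sum is the value 1 at \<open>n = 0\<close>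
    minus the limit 0.\<close>
  from telescope_sums'[OF this]
  have "(\<lambda>n. 1 / (real (n + 2) - 1) - 1 / real (n + 2)) sums 1"
    by (simp add: add.commute)
  then have "((\<lambda>n. 1 / (real (n + 2) - 1) - 1 / real (n + 2)) has_sum 1) UNIV"
    by (rule sums_nonneg_imp_has_sum) (simp add: field_simps)
  moreover have "bij_betw (\<lambda>n. n + 2) UNIV {2::nat..}"
    by (rule bij_betw_byWitness[where f' = "\<lambda>n. n - 2"]) auto
  ultimately show ?thesis
    by (subst (asm) has_sum_reindex_bij_betw[where f = "\<lambda>m. 1 / (real m - 1) - 1 / real m"])
qed

lemma has_sum_perfect_powers:
  "((\<lambda>s. 1 / (real s - 1)) has_sum 1) perfect_powers"
proof -
  let ?f = "\<lambda>(m, n). 1 / real m ^ n"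
  \<comment> \<open>As the terms are nonnegative, it suffices that the row sums over
    \<open>n\<close> are summable in \<open>m\<close>.\<close>
  have "?f summable_on ({2..} \<times> {2..})"
    using has_sum_telescope_inverse has_sum_imp_summable
    by (intro summable_on_SigmaI[where g = "\<lambda>m. 1 / (real m - 1) - 1 / real m"])
       (auto intro: has_sum_inverse_powers_from_2)
  then have "(?f has_sum 1) ({2..} \<times> {2..})"
    using has_sum_telescope_inverse
    by (intro has_sum_SigmaI[where g = "\<lambda>m. 1 / (real m - 1) - 1 / real m"])
       (auto intro: has_sum_inverse_powers_from_2)
  then have "((\<lambda>x. ?f (case x of (r, k, j) \<Rightarrow> (r ^ j, k))) has_sum 1)
      (primitive_bases \<times> {2..} \<times> {1..})"
    by (subst has_sum_reindex_bij_betw[OF bij_betw_all_powers])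
  \<comment> \<open>The exchange of summations: \<open>(r ^ j) ^ k = (r ^ k) ^ j\<close>.\<close>
  also have "(\<lambda>x. ?f (case x of (r, k, j) \<Rightarrow> (r ^ j, k))) =
      (\<lambda>x. ?f (case x of (r, k, j) \<Rightarrow> (r ^ k, j)))"
    by (auto simp: fun_eq_iff simp flip: power_mult) (simp add: mult.commute)
  finally have "(?f has_sum 1) (perfect_powers \<times> {1..})"
    by (subst (asm) has_sum_reindex_bij_betw[OF bij_betw_perfect_powers])
  then show ?thesis
    by (rule has_sum_SigmaD) (simp only: case_prod_conv has_sum_inverse_powers_from_1 perfect_powers_ge_2)
qed

section \<open>Increasing enumeration and its first values\<close>

lemma infinite_perfect_powers: "infinite perfect_powers"
proof (rule infinite_super)
  show "range (\<lambda>n. 2 ^ (n + 2)) \<subseteq> perfect_powers"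
    by (auto intro!: perfect_powersI simp del: power_Suc add_2_eq_Suc')
  show "infinite (range (\<lambda>n. 2 ^ (n + 2) :: nat))"
    by (rule range_inj_infinite) (auto simp: inj_def)
qed

lemma perfect_powers_atMost_36:
  "perfect_powers \<inter> {..36} = {4, 8, 9, 16, 25, 27, 32, 36}"
proof (intro equalityI subsetI)
  fix s assume "s \<in> perfect_powers \<inter> {..36}"
  then obtain m n where mn: "s = m ^ n" "m \<ge> 2" "n \<ge> 2" "m ^ n \<le> 36"
    by (auto simp: perfect_powers_def)
  \<comment> \<open>Bounding \<open>n\<close> below by 2 limits \<open>m\<close>, and bounding
    \<open>m\<close> below by 2 limits \<open>n\<close>; finitely many pairs remain to be
    evaluated.\<close>
  have "m ^ 2 \<le> 36"
    using mn by (intro order_trans[OF power_increasing[of 2 n m]]) auto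
  then have "m ^ 2 < 7 ^ 2"
    by simp
  then have "m < 7"
    by (rule power_less_imp_less_base) simp
  have "2 ^ n \<le> (36::nat)"
    using mn by (intro order_trans[OF power_mono[of 2 m n]]) auto
  then have "(2::nat) ^ n < 2 ^ 6"
    by simp
  then have "n < 6"
    by (rule power_less_imp_less_exp[rotated]) simp
  then have "m \<in> {2, 3, 4, 5, 6}" "n \<in> {2, 3, 4, 5}"
    using mn \<open>m < 7\<close> by auto
  then show "s \<in> {4, 8, 9, 16, 25, 27, 32, 36}"
    using mn by auto
next
  have *: "{2^2, 2^3, 3^2, 4^2, 5^2, 3^3, 2^5, 6^2} \<subseteq> perfect_powers"
    by (auto intro!: perfect_powersI simp del: power_numeral)
  fix s :: nat assume "s \<in> {4, 8, 9, 16, 25, 27, 32, 36}"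
  then show "s \<in> perfect_powers \<inter> {..36}"
    using * by auto
qed

text \<open>The indices with value at most \<open>b\<close> are closed downwards, so they form an
  initial segment, whose length is the number of such values. Sorted lists of distinct elements with
  the same set coincide.\<close>

lemma strict_mono_initial_values:
  fixes a :: "nat \<Rightarrow> 'a::linorder"
  assumes "strict_mono a" "sorted xs" "distinct xs" "set xs = range a \<inter> {..b}"
    and n: "n = length xs"
  shows "map a [0..<n] = xs"
  unfolding n
proof -
  define I where "I = {i. a i \<le> b}"
  have img: "a ` I = set xs"
    using assms(4) by (auto simp: I_def)
  have inj: "inj_on a I"
    using assms(1) by (rule inj_on_subset[OF strict_mono_imp_inj_on]) auto
  have fin: "finite I"
    using img inj by (metis finite_imageD List.finite_set)
  have card: "card I = length xs"
    using card_image[OF inj] img distinct_card[OF assms(3)] by simp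
  have down: "j \<in> I" if "i \<in> I" "j \<le> i" for i j
    using that strict_mono_leD[OF assms(1), of j i] by (auto simp: I_def)
  have "I = {..<length xs}"
  proof (rule card_subset_eq[symmetric])
    show "{..<length xs} \<subseteq> I"
    proof
      fix i assume i: "i \<in> {..<length xs}"
      show "i \<in> I"
      proof (rule ccontr)
        \<comment> \<open>A gap at \<open>i\<close> would leave at most \<open>i\<close> indices in
          \<open>I\<close>, fewer than \<open>length xs\<close>.\<close>
        assume "i \<notin> I"
        then have "I \<subseteq> {..<i}"
          using down by (meson lessThan_iff not_le subsetI)
        then have "card I \<le> i"
          using card_mono[of "{..<i}" I] by simp
        then show False
          using i card by simp
      qed
    qed
  qed (use fin card in auto)
  then have "set (map a [0..<length xs]) = set xs"
    using img by (simp add: atLeast0LessThan)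
  moreover have "sorted (map a [0..<length xs])"
    using strict_mono_leD[OF assms(1)] by (auto simp: sorted_iff_nth_mono)
  moreover have "distinct (map a [0..<length xs])"
    using strict_mono_eq[OF assms(1)] by (auto simp: distinct_map inj_on_def)
  ultimately show "map a [0..<length xs] = xs"
    using assms(2,3) by (intro sorted_distinct_set_unique)
qed

text \<open>Transfers the results to integers; the work is done in \<open>nat\<close>, a well-order,
  where \<open>enumerate\<close> is available.\<close>

lemma proper_powers_eq: "proper_powers = int ` perfect_powers"
proof (intro equalityI subsetI)
  fix s assume "s \<in> proper_powers"
  then obtain m n where mn: "s = m ^ n" "m \<ge> 2" "n \<ge> 2"
    by (auto simp: proper_powers_def)
  then have "s = int (nat m ^ n)" "nat m \<ge> 2"
    by auto
  then show "s \<in> int ` perfect_powers"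
    using mn perfect_powersI by blast
next
  fix s assume "s \<in> int ` perfect_powers"
  then obtain m n where "s = int m ^ n" "m \<ge> 2" "n \<ge> 2"
    by (auto simp: perfect_powers_def)
  then show "s \<in> proper_powers"
    unfolding proper_powers_def by (auto intro!: exI[of _ "int m"])
qed

theorem theorem2p1p1:
  shows "((\<lambda>s::int. 1 / (real_of_int s - 1)) has_sum 1) proper_powers
    \<and> (\<exists>a :: nat \<Rightarrow> int. strict_mono a \<and> range a = proper_powers
          \<and> map a [0..<8] = [4, 8, 9, 16, 25, 27, 32, 36]
          \<and> (\<lambda>k. 1 / (real_of_int (a k) - 1)) sums 1)"
proof (intro conjI exI)
  define e where "e = enumerate perfect_powers"
  have mono: "strict_mono e"
    using infinite_perfect_powers by (auto simp: e_def strict_mono_def enumerate_mono)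
  have bij: "bij_betw e UNIV perfect_powers"
    using infinite_perfect_powers unfolding e_def by (rule bij_enumerate)
  then have range: "range e = perfect_powers"
    by (rule bij_betw_imp_surj_on)
  show "((\<lambda>s::int. 1 / (real_of_int s - 1)) has_sum 1) proper_powers"
    using has_sum_perfect_powers unfolding proper_powers_eq
    by (subst has_sum_reindex) (auto simp: o_def)
  show "strict_mono (\<lambda>n. int (e n))"
    using mono by (simp add: strict_mono_def)
  show "range (\<lambda>n. int (e n)) = proper_powers"
    using range by (simp add: proper_powers_eq image_image[symmetric])
  have "map e [0..<8] = [4, 8, 9, 16, 25, 27, 32, 36]"
    using mono range perfect_powers_atMost_36
    by (intro strict_mono_initial_values[where b = 36]) auto
  from arg_cong[OF this, of "map int"]
  show "map (\<lambda>n. int (e n)) [0..<8] = [4, 8, 9, 16, 25, 27, 32, 36]"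
    by (simp only: map_map o_def list.map of_nat_numeral)
  \<comment> \<open>The unordered sum is reindexed along the enumeration; over all naturals it
    yields the ordinary series.\<close>
  have "((\<lambda>k. 1 / (real (e k) - 1)) has_sum 1) UNIV"
    using has_sum_perfect_powers by (subst has_sum_reindex_bij_betw[OF bij])
  then show "(\<lambda>k. 1 / (real_of_int (int (e k)) - 1)) sums 1"
    by (simp add: has_sum_imp_sums)
qed

end
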